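(* Let $F$ be a field of characteristic $p>0$, complete with respect to a non-Archimedean norm $|\cdot|_F$, and let $(\mathcal{U},\mathbf{eval})$ be an umbral calculus on $F[[T]]$. Let $\mathcal{F},\widehat{\mathcal{F}}:F\to\mathcal{U}$ be umbral maps. Then the flow map $\mathcal{D}_{\mathcal{F}}$ is a dual of the flow map $\mathcal{D}_{\widehat{\mathcal{F}}}$ if and only if there exists an additive isomorphism $\phi$ such that $$\widehat{\mathcal{F}}_k(x)=\mathbf{eval}\big((H^{(-1)}(\mathcal{F}(x)))^k\big)$$ for all $k\ge0$ and all $x\in\mathcal{A}_{\mathcal{F}}\cap\mathcal{A}_{\widehat{\mathcal{F}}}$, where $H(T)=\phi(T)\in F_b[[T]]$ is the generator of $\phi$ and $H^{(-1)}(T)$ is its composition inverse.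
   Context: An umbral calculus on $F[[T]]$ is a pair $(\mathcal{U},\mathbf{eval})$ where $\mathcal{U}$ is a set of indeterminates called umbrae and $\mathbf{eval}:F[[T]][\mathcal{U}]\to F[[T]]$ is a linear map (over $F[[T]]$) with $\mathbf{eval}(1)=1$, $\mathbf{eval}(\alpha^n)\in F$ for every umbra $\alpha$, $n\ge0$, and $\mathbf{eval}(\alpha_1^{n_1}\cdots\alpha_m^{n_m})=\prod_i\mathbf{eval}(\alpha_i^{n_i})$ for distinct umbrae. $\mathbf{eval}$ is extended to power series in finitely many umbrae with coefficients in $F[[T]]$ whenever, coefficientwise in $T$, the resulting series in $F$ converge ("admissible power series"), by applying it termwise. A power series $\sum a_mT^m$ is bounded if $\sup_m|a_m|_F<\infty$ (strictly, there is $c$ with $|a_m|_F<c$); $F_b[[T]]$ is the algebra of bounded power series. $\mathbf{D}^{(k)}$ is the $k$-th Hasse derivative: $\mathbf{D}^{(k)}T^n=\binom nkT^{n-k}$ ($n\ge k$), $0$ otherwise. An umbral map is a map $\mathcal{F}:F\to\mathcal{U}$; $\mathcal{F}_k(x):=\mathbf{eval}(\mathcal{F}(x)^k)$; $\mathcal{A}_{\mathcal{F}}=\{x\in F:\mathcal{F}_k(x)\to0\}$; for $x\in\mathcal{A}_{\mathcal{F}}$, $\mathcal{D}_{\mathcal{F}}(x)=\sum_{k\ge0}\mathcal{F}_k(x)\mathbf{D}^{(k)}$, an operator on $F_b[[T]]$ (it maps $F_b[[T]]$ to itself); the flow map $\mathcal{D}_{\mathcal{F}}$ sends $x\mapsto\mathcal{D}_{\mathcal{F}}(x)$.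 Let $\mathcal{O}_F=\{x\in F:|x|_F\le1\}$. An algebra isomorphism $\phi:F[[T]]\to F[[T]]$, $\phi(P(T))=P(H(T))$, is additive if $H(T)=\phi(T)$ is bounded, involves only powers $T^{p^m}$, and $\mathbf{D}(H(T))\in\mathcal{O}_F^\times$ (i.e. the coefficient of $T$ has norm $1$); $H$ is called the generator of $\phi$, and its composition inverse $H^{(-1)}$ is the generator of $\phi^{-1}$. An additive isomorphism maps $F_b[[T]]$ onto itself. The flow map $\mathcal{D}_{\mathcal{F}}$ is a dual of $\mathcal{D}_{\widehat{\mathcal{F}}}$ if there is an additive isomorphism $\phi$ with $\phi\circ\mathcal{D}_{\mathcal{F}}(x)=\mathcal{D}_{\widehat{\mathcal{F}}}(x)\circ\phi$ on $F_b[[T]]$ for all $x\in\mathcal{A}_{\mathcal{F}}\cap\mathcal{A}_{\widehat{\mathcal{F}}}$.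
   Formalization: Additive isomorphisms are required by definition to map F_b[[T]] onto itself (equivalently, H has all coefficients of norm ≤ 1); this does not follow from the listed conditions, e.g. H = T + cT^p with |c| > 1, for which the composition in the definition of dual is undefined. *)

theory Defs
  imports
    "HOL-Analysis.Analysis"
    "HOL-Computational_Algebra.Computational_Algebra"
    "HOL-Library.Poly_Mapping"
begin

text \<open>
  A field that is complete for a multiplicative non-Archimedean norm. The library's constant
  \<open>norm\<close> is restricted to real vector spaces, which have characteristic 0, so the norm gets a name
  of its own; limits and series are the library's, for the metric induced by it.
\<close>

class nonarch_complete_field = field + complete_space +
  fixes vnorm :: "'a \<Rightarrow> real"
  assumes dist_vnorm: "dist x y = vnorm (x - y)"
    and vnorm_mult: "vnorm (x * y) = vnorm x * vnorm y"
    and vnorm_ultrametric: "vnorm (x + y) \<le> max (vnorm x) (vnorm y)"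

definition bounded_fps :: "'a::nonarch_complete_field fps set" where
  "bounded_fps = {P. \<exists>c. \<forall>m. vnorm (fps_nth P m) < c}"

definition hasse_deriv :: "nat \<Rightarrow> 'a::field fps \<Rightarrow> 'a fps" where
  "hasse_deriv k P = Abs_fps (\<lambda>n. of_nat ((n + k) choose k) * fps_nth P (n + k))"


section \<open>Umbral calculus\<close>

text \<open>
  The umbrae are the elements of the type \<open>'u\<close>, and \<open>('u \<Rightarrow>\<^sub>0 nat) \<Rightarrow>\<^sub>0 'a fps\<close> is the ring of
  polynomials in them over \<open>'a fps\<close>: finitely supported families of coefficients indexed by
  monomials, a monomial being a finitely supported family of exponents.
\<close>

type_synonym ('u, 'a) umbral_poly = "('u \<Rightarrow>\<^sub>0 nat) \<Rightarrow>\<^sub>0 'a fps"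

definition umbra :: "'u \<Rightarrow> ('u, 'a::field) umbral_poly" where
  "umbra \<alpha> = Poly_Mapping.single (Poly_Mapping.single \<alpha> 1) 1"

definition umbral_calculus :: "(('u, 'a::field) umbral_poly \<Rightarrow> 'a fps) \<Rightarrow> bool" where
  "umbral_calculus ev \<longleftrightarrow>
     (\<forall>P Q. ev (P + Q) = ev P + ev Q) \<and>
     (\<forall>c P. ev (Poly_Mapping.single 0 c * P) = c * ev P) \<and>
     ev 1 = 1 \<and>
     (\<forall>\<alpha> n. ev (umbra \<alpha> ^ n) \<in> range fps_const) \<and>
     (\<forall>A n. finite A \<longrightarrow>
        ev (\<Prod>\<alpha>\<in>A. umbra \<alpha> ^ n \<alpha>) = (\<Prod>\<alpha>\<in>A. ev (umbra \<alpha> ^ n \<alpha>)))"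

text \<open>
  A power series in finitely many umbrae over \<open>'a fps\<close> is given by its coefficient family, indexed
  by monomials.
\<close>

type_synonym ('u, 'a) umbral_series = "('u \<Rightarrow>\<^sub>0 nat) \<Rightarrow> 'a fps"

definition umbral_admissible ::
    "(('u, 'a::nonarch_complete_field) umbral_poly \<Rightarrow> 'a fps) \<Rightarrow> ('u, 'a) umbral_series \<Rightarrow> bool" where
  "umbral_admissible ev S \<longleftrightarrow>
     (\<exists>A. finite A \<and> (\<forall>m. S m \<noteq> 0 \<longrightarrow> Poly_Mapping.keys m \<subseteq> A)) \<and>
     (\<forall>j. (\<lambda>m. fps_nth (S m * ev (Poly_Mapping.single m 1)) j) summable_on UNIV)"

definition umbral_eval_series ::
    "(('u, 'a::nonarch_complete_field) umbral_poly \<Rightarrow> 'a fps) \<Rightarrow> ('u, 'a) umbral_series \<Rightarrow> 'a fps" where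
  "umbral_eval_series ev S =
     Abs_fps (\<lambda>j. \<Sum>\<^sub>\<infinity>m. fps_nth (S m * ev (Poly_Mapping.single m 1)) j)"

text \<open>
  The series \<open>G(\<alpha>)\<close> in the single umbra \<open>\<alpha>\<close>. Since \<open>\<alpha>\<close> is an indeterminate, \<open>G(\<alpha>)^k\<close> is the series
  obtained by substituting \<open>\<alpha>\<close> into \<open>G ^ k\<close>.
\<close>

definition umbra_subst :: "'a::field fps \<Rightarrow> 'u \<Rightarrow> ('u, 'a) umbral_series" where
  "umbra_subst G \<alpha> =
     (\<lambda>m. if Poly_Mapping.keys m \<subseteq> {\<alpha>} then fps_const (fps_nth G (Poly_Mapping.lookup m \<alpha>)) else 0)"


section \<open>Umbral maps and flow maps\<close>

text \<open>The value of \<open>ev\<close> on a power of an umbra is a constant series, read here as an element of \<open>'a\<close>.\<close>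

definition umbral_coeff ::
    "(('u, 'a::field) umbral_poly \<Rightarrow> 'a fps) \<Rightarrow> ('a \<Rightarrow> 'u) \<Rightarrow> nat \<Rightarrow> 'a \<Rightarrow> 'a" where
  "umbral_coeff ev \<F> k x = fps_nth (ev (umbra (\<F> x) ^ k)) 0"

definition flow_domain ::
    "(('u, 'a::nonarch_complete_field) umbral_poly \<Rightarrow> 'a fps) \<Rightarrow> ('a \<Rightarrow> 'u) \<Rightarrow> 'a set" where
  "flow_domain ev \<F> = {x. (\<lambda>k. umbral_coeff ev \<F> k x) \<longlonglongrightarrow> 0}"

text \<open>The series of operators is summed coefficientwise; it converges for \<open>x\<close> in
  \<open>flow_domain ev \<F>\<close> and \<open>P\<close> in \<open>bounded_fps\<close>.\<close>

definition flow_map ::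
    "(('u, 'a::nonarch_complete_field) umbral_poly \<Rightarrow> 'a fps) \<Rightarrow> ('a \<Rightarrow> 'u) \<Rightarrow> 'a \<Rightarrow> 'a fps \<Rightarrow> 'a fps" where
  "flow_map ev \<F> x P =
     Abs_fps (\<lambda>m. suminf (\<lambda>k. umbral_coeff ev \<F> k x * fps_nth (hasse_deriv k P) m))"

definition fps_algebra_iso :: "('a::field fps \<Rightarrow> 'a fps) \<Rightarrow> bool" where
  "fps_algebra_iso \<phi> \<longleftrightarrow>
     bij \<phi> \<and> \<phi> 1 = 1 \<and>
     (\<forall>P Q. \<phi> (P + Q) = \<phi> P + \<phi> Q) \<and>
     (\<forall>P Q. \<phi> (P * Q) = \<phi> P * \<phi> Q) \<and>
     (\<forall>c P. \<phi> (fps_const c * P) = fps_const c * \<phi> P)"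

text \<open>
  The generator of \<open>\<phi>\<close> is \<open>H = \<phi> fps_X\<close>. Its derivative is the constant \<open>fps_nth H 1\<close>, since all
  other exponents are divisible by the characteristic. The last clause, that \<open>\<phi>\<close> maps the bounded
  series onto themselves, does not follow from the others: for \<open>H = T + c T^p\<close> with \<open>vnorm c > 1\<close>,
  the image of the bounded series \<open>1 + T + T^2 + \<dots>\<close> is unbounded. It is needed for
  \<open>flow_map ev \<F> x \<circ> \<phi>\<close> to make sense on bounded series, and amounts to \<open>H\<close> having all its
  coefficients of norm at most 1.
\<close>

definition additive_iso :: "('a::nonarch_complete_field fps \<Rightarrow> 'a fps) \<Rightarrow> bool" where
  "additive_iso \<phi> \<longleftrightarrow>
     fps_algebra_iso \<phi> \<and>
     (\<forall>P. \<phi> P = fps_compose P (\<phi> fps_X)) \<and>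
     \<phi> fps_X \<in> bounded_fps \<and>
     (\<forall>n. fps_nth (\<phi> fps_X) n \<noteq> 0 \<longrightarrow> (\<exists>m. n = CHAR('a) ^ m)) \<and>
     vnorm (fps_nth (\<phi> fps_X) 1) = 1 \<and>
     \<phi> ` bounded_fps = bounded_fps"

definition dual_flow ::
    "(('u, 'a::nonarch_complete_field) umbral_poly \<Rightarrow> 'a fps) \<Rightarrow> ('a \<Rightarrow> 'u) \<Rightarrow> ('a \<Rightarrow> 'u) \<Rightarrow> bool" where
  "dual_flow ev \<F> \<G> \<longleftrightarrow>
     (\<exists>\<phi>. additive_iso \<phi> \<and>
        (\<forall>x \<in> flow_domain ev \<F> \<inter> flow_domain ev \<G>. \<forall>P \<in> bounded_fps.
           \<phi> (flow_map ev \<F> x P) = flow_map ev \<G> x (\<phi> P)))"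

end

theory Submission
  imports Defs
begin

text \<open>
  Fix \<open>x\<close>, write \<open>f\<^sub>n\<close> and \<open>g\<^sub>n\<close> for the coefficients of the two flow maps at \<open>x\<close>, and let \<open>K\<close> be the
  composition inverse of the generator of \<open>\<phi>\<close>. Comparing constant terms in the intertwining relation
  at \<open>P = K ^ k\<close> gives \<open>g\<^sub>k = \<Sum>n. f\<^sub>n [T\<^sup>n] K ^ k\<close>, which is the umbral identity. Conversely, \<open>K\<close> is
  additive, so expanding \<open>Q(K(T) + K(S))\<close> shows that the \<open>n\<close>-th Hasse derivative of \<open>Q oo K\<close> is
  \<open>\<Sum>j. [T\<^sup>n] K ^ j (hasse_deriv j Q oo K)\<close>. Since \<open>\<phi>\<close> preserves bounded series, all coefficients of
  \<open>K\<close> have norm at most 1; hence the summations over \<open>n\<close> and \<open>j\<close> may be exchanged, and the umbral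
  identity yields the intertwining relation.
\<close>

unbundle no vec_syntax

section \<open>Series in a complete non-Archimedean field\<close>

lemma vnorm_eq_dist: "vnorm x = dist x (0::'a::nonarch_complete_field)"
  by (simp add: dist_vnorm)

lemma vnorm_nonneg [simp]: "0 \<le> vnorm (x::'a::nonarch_complete_field)"
  by (simp add: vnorm_eq_dist)

lemma vnorm_eq_0_iff [simp]: "vnorm (x::'a::nonarch_complete_field) = 0 \<longleftrightarrow> x = 0"
  by (simp add: vnorm_eq_dist)

lemma vnorm_0 [simp]: "vnorm (0::'a::nonarch_complete_field) = 0"
  by simp

lemma vnorm_minus [simp]: "vnorm (- x) = vnorm (x::'a::nonarch_complete_field)"
  using dist_commute[of x 0] by (simp add: dist_vnorm)

lemma vnorm_diff: "vnorm (x - y) \<le> max (vnorm x) (vnorm (y::'a::nonarch_complete_field))"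
  using vnorm_ultrametric[of x "- y"] by simp

lemma vnorm_1 [simp]: "vnorm (1::'a::nonarch_complete_field) = 1"
proof -
  have "vnorm (1::'a) * vnorm (1::'a) = vnorm (1::'a)"
    using vnorm_mult[of "1::'a" 1] by simp
  moreover have "vnorm (1::'a) \<noteq> 0" by simp
  ultimately show ?thesis by simp
qed

lemma vnorm_power: "vnorm (x ^ n) = vnorm (x::'a::nonarch_complete_field) ^ n"
  by (induction n) (simp_all add: vnorm_mult)

lemma vnorm_of_nat_le_1: "vnorm (of_nat n :: 'a::nonarch_complete_field) \<le> 1"
proof (induction n)
  case (Suc n)
  then show ?case using vnorm_ultrametric[of "1::'a" "of_nat n"] by simp
qed simp

lemma vnorm_sum_le:
  fixes f :: "'i \<Rightarrow> 'a::nonarch_complete_field"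
  assumes "\<And>i. i \<in> A \<Longrightarrow> vnorm (f i) \<le> B" and "0 \<le> B"
  shows "vnorm (sum f A) \<le> B"
  using assms
proof (induction A rule: infinite_finite_induct)
  case (insert i A)
  then show ?case
    using vnorm_ultrametric[of "f i" "sum f A"] by (smt (verit) insert_iff sum.insert)
qed simp_all

text \<open>The remaining terms have a sum of strictly smaller norm. Writing \<open>f a\<close> as
  the full sum minus that remainder, the ultrametric inequality leaves only the full sum to bound
  it.\<close>

lemma vnorm_dominant_le_sum:
  fixes f :: "'i \<Rightarrow> 'a::nonarch_complete_field"
  assumes "finite A" "a \<in> A" and dom: "\<And>i. i \<in> A \<Longrightarrow> i \<noteq> a \<Longrightarrow> vnorm (f i) < vnorm (f a)"
  shows "vnorm (f a) \<le> vnorm (sum f A)"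
proof (cases "f a = 0")
  case False
  have "vnorm (sum f B) < vnorm (f a)" if "finite B" "B \<subseteq> A - {a}" for B
    using that
  proof (induction B rule: finite_induct)
    case empty
    then show ?case using False vnorm_nonneg[of "f a"] by (simp add: less_le)
  next
    case (insert i B)
    then show ?case
      using vnorm_ultrametric[of "f i" "sum f B"] dom[of i] by auto
  qed
  then have "vnorm (sum f (A - {a})) < vnorm (f a)"
    using assms(1) by simp
  moreover have "f a = sum f A - sum f (A - {a})"
    using assms(1,2) by (simp add: sum.remove)
  ultimately show ?thesis
    using vnorm_diff[of "sum f A" "sum f (A - {a})"] by auto
qed simp

lemma tendsto_vnorm_iff:
  "(f \<longlongrightarrow> l) F \<longleftrightarrow> ((\<lambda>x. vnorm (f x - (l::'a::nonarch_complete_field))) \<longlongrightarrow> 0) F"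
  by (subst tendsto_dist_iff) (simp add: dist_vnorm)

text \<open>Continuity of addition makes \<open>tendsto_add\<close> and \<open>sums_sum\<close>
  available for these fields.\<close>

instance nonarch_complete_field \<subseteq> topological_comm_monoid_add
proof
  fix a b :: 'a
  have "((\<lambda>x. vnorm (fst x - a) + vnorm (snd x - b)) \<longlongrightarrow> 0 + 0) (nhds a \<times>\<^sub>F nhds b)"
    using filterlim_fst[of "nhds a" "nhds b"] filterlim_snd[of "nhds b" "nhds a"]
    by (intro tendsto_add) (simp_all add: tendsto_vnorm_iff)
  moreover have "vnorm (fst x + snd x - (a + b)) \<le> vnorm (fst x - a) + vnorm (snd x - b)"
    for x
    using vnorm_ultrametric[of "fst x - a" "snd x - b"]
      vnorm_nonneg[of "fst x - a"] vnorm_nonneg[of "snd x - b"]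
    by (smt (verit) add_diff_add)
  ultimately show "((\<lambda>x. fst x + snd x) \<longlongrightarrow> a + b) (nhds a \<times>\<^sub>F nhds b)"
    unfolding tendsto_vnorm_iff[of "\<lambda>x. fst x + snd x"]
    by (auto intro: tendsto_sandwich[where f = "\<lambda>_. 0"
          and h = "\<lambda>x. vnorm (fst x - a) + vnorm (snd x - b)"])
qed

lemma tendsto_null_mult_bounded:
  fixes f g :: "nat \<Rightarrow> 'a::nonarch_complete_field"
  assumes "f \<longlonglongrightarrow> 0" and bd: "\<And>n. vnorm (g n) \<le> B"
  shows "(\<lambda>n. f n * g n) \<longlonglongrightarrow> 0"
proof -
  have "(\<lambda>n. vnorm (f n) * B) \<longlonglongrightarrow> 0 * B"
    using assms(1) by (intro tendsto_mult_right) (simp add: tendsto_vnorm_iff)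
  moreover have "vnorm (f n * g n) \<le> vnorm (f n) * B" for n
    using bd by (simp add: vnorm_mult mult_left_mono)
  ultimately show ?thesis
    unfolding tendsto_vnorm_iff[of "\<lambda>n. f n * g n"]
    by (auto intro: tendsto_sandwich[where f = "\<lambda>_. 0" and h = "\<lambda>n. vnorm (f n) * B"])
qed

lemma sums_mult_left_vnorm:
  fixes f :: "nat \<Rightarrow> 'a::nonarch_complete_field"
  assumes "f sums s"
  shows "(\<lambda>n. c * f n) sums (c * s)"
proof -
  have "(\<lambda>n. vnorm c * vnorm ((\<Sum>i<n. f i) - s)) \<longlonglongrightarrow> vnorm c * 0"
    using assms unfolding sums_def tendsto_vnorm_iff[of "\<lambda>n. \<Sum>i<n. f i"]
    by (intro tendsto_mult_left)
  then show ?thesis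
    unfolding sums_def tendsto_vnorm_iff[of "\<lambda>n. \<Sum>i<n. c * f i"]
    by (simp add: right_diff_distrib sum_distrib_left flip: vnorm_mult)
qed

lemma null_seq_small:
  fixes f :: "nat \<Rightarrow> 'a::nonarch_complete_field"
  assumes "f \<longlonglongrightarrow> 0" "e > 0"
  obtains N where "\<And>n. n \<ge> N \<Longrightarrow> vnorm (f n) \<le> e"
proof -
  have "\<forall>\<^sub>F n in sequentially. dist (f n) 0 < e"
    using assms tendstoD by blast
  then show ?thesis
    using that by (auto simp: eventually_sequentially vnorm_eq_dist intro: less_imp_le)
qed

text \<open>By the ultrametric inequality a block of terms is no larger than its largest term, so
  small terms alone make the partial sums Cauchy.\<close>

lemma summable_null_seq:
  fixes f :: "nat \<Rightarrow> 'a::nonarch_complete_field"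
  assumes "f \<longlonglongrightarrow> 0"
  shows "summable f"
proof -
  have "Cauchy (\<lambda>n. \<Sum>i<n. f i)"
  proof (rule metric_CauchyI)
    fix e :: real assume e: "e > 0"
    then obtain N where N: "\<And>n. n \<ge> N \<Longrightarrow> vnorm (f n) \<le> e / 2"
      using null_seq_small[OF assms, of "e / 2"] by auto
    have *: "dist (\<Sum>i<m. f i) (\<Sum>i<n. f i) < e" if "N \<le> n" "n \<le> m" for m n
    proof -
      have "(\<Sum>i<m. f i) - (\<Sum>i<n. f i) = sum f {n..<m}"
        using that by (simp add: sum_diff_nat_ivl lessThan_atLeast0)
      moreover have "vnorm (sum f {n..<m}) \<le> e / 2"
        using that N e by (intro vnorm_sum_le) auto
      ultimately show ?thesis using e by (simp add: dist_vnorm)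
    qed
    show "\<exists>M. \<forall>m\<ge>M. \<forall>n\<ge>M. dist (\<Sum>i<m. f i) (\<Sum>i<n. f i) < e"
      using * by (metis dist_commute nle_le)
  qed
  then show ?thesis
    by (simp add: summable_iff_convergent Cauchy_convergent_iff)
qed

text \<open>If the tail exceeded \<open>B\<close>, a late partial sum would lie closer to
  \<open>s\<close> than the norm of the tail, while the block between it and the first
  \<open>N\<close> terms is at most \<open>B\<close>; the ultrametric inequality forbids
  this.\<close>

lemma vnorm_sums_tail_le:
  fixes f :: "nat \<Rightarrow> 'a::nonarch_complete_field"
  assumes "f sums s" and B: "\<And>n. n \<ge> N \<Longrightarrow> vnorm (f n) \<le> B" and "0 \<le> B"
  shows "vnorm (s - (\<Sum>n<N. f n)) \<le> B"
proof (rule ccontr)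
  assume less: "\<not> ?thesis"
  define e where "e = vnorm (s - (\<Sum>n<N. f n))"
  have "e > 0" using less assms(3) by (simp add: e_def)
  then have "\<forall>\<^sub>F M in sequentially. dist (\<Sum>n<M. f n) s < e"
    using assms(1) by (auto simp: sums_def dest: tendstoD)
  then obtain M0 where M0: "\<And>M. M \<ge> M0 \<Longrightarrow> dist (\<Sum>n<M. f n) s < e"
    by (auto simp: eventually_sequentially)
  define M where "M = max M0 N"
  have "(\<Sum>n<M. f n) - (\<Sum>n<N. f n) = sum f {N..<M}"
    by (simp add: sum_diff_nat_ivl lessThan_atLeast0 M_def)
  moreover have "vnorm (sum f {N..<M}) \<le> B"
    using assms by (intro vnorm_sum_le) auto
  moreover have "vnorm (s - (\<Sum>n<M. f n)) < e"
    using M0[of M] by (simp add: M_def dist_commute[of _ s] flip: dist_vnorm)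
  moreover have "e \<le> max (vnorm (s - (\<Sum>n<M. f n))) (vnorm ((\<Sum>n<M. f n) - (\<Sum>n<N. f n)))"
    using vnorm_ultrametric[of "s - (\<Sum>n<M. f n)" "(\<Sum>n<M. f n) - (\<Sum>n<N. f n)"]
    by (simp add: e_def)
  moreover have "B < e" using less by (simp add: e_def)
  ultimately show False by auto
qed

text \<open>Bridges the ordered sums of \<open>flow_map\<close> and the unordered sums of
  \<open>umbral_eval_series\<close>. Once a finite set contains the first \<open>N\<close> indices,
  both its extra terms and the tail of the series are small.\<close>

lemma has_sum_null_seq:
  fixes f :: "nat \<Rightarrow> 'a::nonarch_complete_field"
  assumes "f \<longlonglongrightarrow> 0"
  shows "(f has_sum suminf f) UNIV"
  unfolding has_sum_def tendsto_iff eventually_finite_subsets_at_top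
proof (intro allI impI)
  fix e :: real assume e: "e > 0"
  then obtain N where N: "\<And>n. n \<ge> N \<Longrightarrow> vnorm (f n) \<le> e / 2"
    using null_seq_small[OF assms, of "e / 2"] by auto
  have "dist (sum f Y) (suminf f) < e" if Y: "finite Y" "{..<N} \<subseteq> Y" for Y
  proof -
    have "vnorm (suminf f - sum f {..<N}) \<le> e / 2"
      using vnorm_sums_tail_le[OF summable_sums[OF summable_null_seq[OF assms]] N] e by simp
    moreover have "vnorm (sum f (Y - {..<N})) \<le> e / 2"
      using N e by (intro vnorm_sum_le) auto
    ultimately have "vnorm (sum f (Y - {..<N}) - (suminf f - sum f {..<N})) \<le> e / 2"
      using order_trans[OF vnorm_diff max.boundedI] by blast
    moreover have "sum f (Y - {..<N}) - (suminf f - sum f {..<N}) = sum f Y - suminf f"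
      using Y by (simp add: sum_diff)
    ultimately have "vnorm (sum f Y - suminf f) \<le> e / 2" by metis
    then show ?thesis
      using e by (simp add: dist_vnorm)
  qed
  then show "\<exists>X. finite X \<and> X \<subseteq> UNIV \<and>
      (\<forall>Y. finite Y \<and> X \<subseteq> Y \<and> Y \<subseteq> UNIV \<longrightarrow> dist (sum f Y) (suminf f) < e)"
    by (intro exI[of _ "{..<N}"]) auto
qed

text \<open>Fubini for a lower triangular array with uniformly bounded entries and null weights. The
  partial sums in the two orders differ only by column tails beyond \<open>N\<close>, which are
  small uniformly in \<open>j\<close>; in the ultrametric these errors do not accumulate.\<close>

lemma sums_triangle_swap:
  fixes f :: "nat \<Rightarrow> 'a::nonarch_complete_field"
  assumes f: "f \<longlonglongrightarrow> 0" and c: "\<And>n j. vnorm (c n j) \<le> C"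
    and tri: "\<And>n j. n < j \<Longrightarrow> c n j = 0"
    and g: "\<And>j. (\<lambda>n. f n * c n j) sums g j"
  shows "g sums suminf (\<lambda>n. f n * (\<Sum>j\<le>n. c n j))"
proof -
  define h where "h n = (\<Sum>j\<le>n. c n j)" for n
  have C: "0 \<le> C" using c[of 0 0] vnorm_nonneg[of "c 0 0"] by linarith
  have "vnorm (h n) \<le> C" for n
    unfolding h_def using c C by (intro vnorm_sum_le) auto
  then have "(\<lambda>n. f n * h n) sums suminf (\<lambda>n. f n * h n)"
    by (intro summable_sums summable_null_seq tendsto_null_mult_bounded[OF f])
  then have lim: "(\<lambda>N. \<Sum>n<N. f n * h n) \<longlonglongrightarrow> suminf (\<lambda>n. f n * h n)"
    by (simp add: sums_def)
  have "(\<lambda>N. (\<Sum>j<N. g j) - (\<Sum>n<N. f n * h n)) \<longlonglongrightarrow> 0"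
  proof (rule metric_LIMSEQ_I)
    fix e :: real assume e: "e > 0"
    \<comment> \<open>The summand 1 covers the case that \<open>C\<close> is 0.\<close>
    have "e / (2 * (C + 1)) > 0" using e C by simp
    then obtain N0 where N0: "\<And>n. n \<ge> N0 \<Longrightarrow> vnorm (f n) \<le> e / (2 * (C + 1))"
      using null_seq_small[OF f] by metis
    have small: "vnorm (f n * c n j) \<le> e / 2" if "n \<ge> N0" for n j
    proof -
      have "vnorm (f n * c n j) \<le> e / (2 * (C + 1)) * C"
        unfolding vnorm_mult using N0[OF that] c e C by (intro mult_mono) auto
      also have "\<dots> \<le> e / 2" using e C by (simp add: field_simps)
      finally show ?thesis .
    qed
    have "dist ((\<Sum>j<N. g j) - (\<Sum>n<N. f n * h n)) 0 < e" if "N \<ge> N0" for N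
    proof -
      \<comment> \<open>Rows with index below \<open>N\<close> lie entirely in the first
        \<open>N\<close> columns, so the triangle may be filled up to a square.\<close>
      have "(\<Sum>n<N. f n * h n) = (\<Sum>n<N. \<Sum>j<N. f n * c n j)"
        unfolding h_def sum_distrib_left using tri
        by (intro sum.cong refl sum.mono_neutral_left) auto
      also have "\<dots> = (\<Sum>j<N. \<Sum>n<N. f n * c n j)" by (rule sum.swap)
      finally have "(\<Sum>j<N. g j) - (\<Sum>n<N. f n * h n) = (\<Sum>j<N. g j - (\<Sum>n<N. f n * c n j))"
        by (simp add: sum_subtractf)
      also have "vnorm \<dots> \<le> e / 2"
        using vnorm_sums_tail_le[OF g, where N = N and B = "e / 2"] small that e
        by (intro vnorm_sum_le) auto
      finally show ?thesis using e by (simp add: vnorm_eq_dist)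
    qed
    then show "\<exists>N0. \<forall>N\<ge>N0. dist ((\<Sum>j<N. g j) - (\<Sum>n<N. f n * h n)) 0 < e" by blast
  qed
  from tendsto_add[OF this lim] show ?thesis
    by (simp add: sums_def h_def)
qed


section \<open>Hasse derivatives of additive compositions\<close>

text \<open>Raising to the power \<open>q\<close> is additive in characteristic p. That rule applies
  to finite sums only, so \<open>K\<close> is first cut after degree \<open>n\<close>; the remainder
  contributes only from degree \<open>Suc n * q\<close> on.\<close>

lemma fps_frobenius_nth:
  fixes K :: "'a::field fps"
  assumes p: "prime CHAR('a)" and q: "q = CHAR('a) ^ a"
  shows "(K ^ q) $ n = (if q dvd n then (K $ (n div q)) ^ q else 0)"
proof -
  have q0: "q > 0" using p q by (simp add: prime_gt_0_nat)
  define A where "A = (\<Sum>i\<le>n. fps_const (K $ i) * fps_X ^ i)"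
  define B where "B = fps_shift (Suc n) K"
  have "K = A + fps_X ^ Suc n * B"
  proof (rule fps_ext)
    fix m
    have "A $ m = (if m \<le> n then K $ m else 0)"
      by (simp add: A_def fps_sum_nth mult_delta_right)
    then show "K $ m = (A + fps_X ^ Suc n * B) $ m"
      by (simp add: B_def fps_X_power_mult_nth del: power_Suc)
  qed
  then have "K ^ q = A ^ q + fps_X ^ (Suc n * q) * B ^ q"
    using freshmans_dream'[of q a A "fps_X ^ Suc n * B"] p q
    by (simp only: semiring_char_fps power_mult_distrib power_mult)
  moreover have "n < Suc n * q" using q0 by (cases q) auto
  ultimately have "(K ^ q) $ n = (A ^ q) $ n"
    by (simp add: fps_X_power_mult_nth del: mult_Suc)
  also have "A ^ q = (\<Sum>i\<le>n. fps_const ((K $ i) ^ q) * fps_X ^ (i * q))"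
    unfolding A_def using p q
    by (subst freshmans_dream_sum'[of q a]) (simp_all add: power_mult_distrib power_mult)
  also have "\<dots> $ n = (\<Sum>i\<le>n. if n = i * q then (K $ i) ^ q else 0)"
    by (auto simp: fps_sum_nth mult_delta_right intro!: sum.cong)
  also have "\<dots> = (if q dvd n then (K $ (n div q)) ^ q else 0)"
  proof (cases "q dvd n")
    case True
    then have "(\<Sum>i\<le>n. if n = i * q then (K $ i) ^ q else 0) =
        (\<Sum>i\<le>n. if i = n div q then (K $ i) ^ q else 0)"
      using q0 by (intro sum.cong) auto
    then show ?thesis using True by simp
  next
    case False
    then show ?thesis by (auto intro!: sum.neutral)
  qed
  finally show ?thesis .
qed

text \<open>Compare coefficients in (X + 1)^q = X^q + 1.\<close>

lemma of_nat_choose_CHAR_power: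
  assumes p: "prime CHAR('a::field)" and "0 < i" "i < CHAR('a) ^ a"
  shows "of_nat (CHAR('a) ^ a choose i) = (0::'a)"
proof -
  define q where "q = CHAR('a) ^ a"
  have "(fps_X + 1 :: 'a fps) ^ q = fps_X ^ q + 1"
    using freshmans_dream'[of q a "fps_X :: 'a fps" 1] p by (simp add: q_def)
  then have "(\<Sum>k\<le>q. of_nat (q choose k) * (fps_X :: 'a fps) ^ k) $ i = (fps_X ^ q + 1 :: 'a fps) $ i"
    by (simp add: binomial_ring)
  moreover have "(\<Sum>k\<le>q. of_nat (q choose k) * (fps_X :: 'a fps) ^ k) $ i = of_nat (q choose i)"
    using assms by (simp add: fps_sum_nth fps_of_nat[symmetric] mult_delta_right q_def)
  ultimately show ?thesis
    using assms by (simp add: q_def)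
qed

lemma hasse_deriv_nth: "hasse_deriv k P $ n = of_nat ((n + k) choose k) * P $ (n + k)"
  by (simp add: hasse_deriv_def)

text \<open>The expansion of \<open>P(T + S)\<close> in powers of \<open>S\<close>, with coefficients in \<open>F[[T]]\<close>.\<close>

definition hasse_taylor :: "'a::field fps \<Rightarrow> 'a fps fps" where
  "hasse_taylor P = Abs_fps (\<lambda>n. hasse_deriv n P)"

text \<open>In \<open>'a fps fps\<close> the inner variable is T and the outer one is S. Thus
  \<open>fps_lift_const P\<close> stands for P(S), and \<open>fps_const P\<close> for P(T).\<close>

definition fps_lift_const :: "'a::field fps \<Rightarrow> 'a fps fps" where
  "fps_lift_const P = Abs_fps (\<lambda>n. fps_const (P $ n))"

lemma fps_lift_const_nth: "fps_lift_const P $ n = fps_const (P $ n)"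
  by (simp add: fps_lift_const_def)

lemma fps_lift_const_power: "fps_lift_const P ^ j = fps_lift_const (P ^ j)"
proof -
  have mult: "fps_lift_const (P * Q) = fps_lift_const P * fps_lift_const Q" for P Q :: "'a fps"
    by (intro fps_ext) (simp add: fps_lift_const_def fps_mult_nth fps_sum_nth)
  have "fps_lift_const (1 :: 'a fps) = 1"
    by (rule fps_ext) (simp add: fps_lift_const_def)
  then show ?thesis
    by (induction j) (simp_all add: mult)
qed

text \<open>The Leibniz rule, by Vandermonde's convolution. It makes \<open>hasse_taylor\<close>
  multiplicative.\<close>

lemma hasse_deriv_mult:
  "hasse_deriv n (P * Q) = (\<Sum>a\<le>n. hasse_deriv a P * hasse_deriv (n - a) Q)"
proof (rule fps_ext)
  fix m
  let ?h = "\<lambda>a i. of_nat (i choose a) * of_nat ((m + n - i) choose (n - a)) * (P $ i * Q $ (m + n - i))"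
  have "hasse_deriv n (P * Q) $ m =
      (\<Sum>i\<le>m + n. of_nat ((m + n) choose n) * (P $ i * Q $ (m + n - i)))"
    by (simp add: hasse_deriv_nth fps_mult_nth sum_distrib_left atLeast0AtMost)
  also have "\<dots> = (\<Sum>i\<le>m + n. \<Sum>a\<le>n. ?h a i)"
  proof (rule sum.cong[OF refl])
    fix i assume "i \<in> {..m + n}"
    then have "(m + n) choose n = (\<Sum>a\<le>n. (i choose a) * ((m + n - i) choose (n - a)))"
      using vandermonde[of i "m + n - i" n] by simp
    then show "of_nat ((m + n) choose n) * (P $ i * Q $ (m + n - i)) = (\<Sum>a\<le>n. ?h a i)"
      by (simp add: sum_distrib_right)
  qed
  also have "\<dots> = (\<Sum>a\<le>n. \<Sum>i\<le>m + n. ?h a i)" by (rule sum.swap)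
  also have "\<dots> = (\<Sum>a\<le>n. (hasse_deriv a P * hasse_deriv (n - a) Q) $ m)"
  proof (rule sum.cong[OF refl])
    fix a assume a: "a \<in> {..n}"
    \<comment> \<open>One of the two binomial coefficients vanishes when \<open>i < a\<close> or
      \<open>i > m + a\<close>.\<close>
    have "(\<Sum>i\<le>m + n. ?h a i) = (\<Sum>i\<in>{0 + a..m + a}. ?h a i)"
      using a by (intro sum.mono_neutral_right) (auto simp: binomial_eq_0)
    also have "\<dots> = (\<Sum>i\<in>{0..m}. ?h a (i + a))"
      by (rule sum.shift_bounds_cl_nat_ivl)
    also have "\<dots> = (hasse_deriv a P * hasse_deriv (n - a) Q) $ m"
      unfolding fps_mult_nth hasse_deriv_nth
      using a by (intro sum.cong refl) (auto simp: mult_ac)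
    finally show "(\<Sum>i\<le>m + n. ?h a i) = (hasse_deriv a P * hasse_deriv (n - a) Q) $ m" .
  qed
  finally show "hasse_deriv n (P * Q) $ m =
      (\<Sum>a\<le>n. hasse_deriv a P * hasse_deriv (n - a) Q) $ m"
    by (simp add: fps_sum_nth)
qed

lemma hasse_taylor_power: "hasse_taylor (P ^ k) = hasse_taylor P ^ k"
proof -
  have mult: "hasse_taylor (P * Q) = hasse_taylor P * hasse_taylor Q" for P Q :: "'a fps"
    by (rule fps_ext) (simp add: hasse_taylor_def hasse_deriv_mult fps_mult_nth atLeast0AtMost)
  have "hasse_taylor (1 :: 'a fps) = 1"
    by (intro fps_ext) (simp add: hasse_taylor_def hasse_deriv_nth)
  then show ?thesis
    by (induction k) (simp_all add: mult)
qed

definition additive_fps :: "'a::field fps \<Rightarrow> bool" where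
  "additive_fps K \<longleftrightarrow> (\<forall>n. K $ n \<noteq> 0 \<longrightarrow> (\<exists>m. n = CHAR('a) ^ m))"

lemma additive_fps_nth_0:
  assumes "prime CHAR('a::field)" "additive_fps (K :: 'a fps)"
  shows "K $ 0 = 0"
  using assms by (metis additive_fps_def not_prime_0 power_not_zero)

text \<open>This is K(T + S) = K(S) + K(T): at a degree that is a power of p, all mixed terms carry
  a binomial coefficient divisible by p.\<close>

lemma hasse_taylor_additive:
  fixes K :: "'a::field fps"
  assumes p: "prime CHAR('a)" and K: "additive_fps K"
  shows "hasse_taylor K = fps_lift_const K + fps_const K"
proof (intro fps_ext)
  fix n m
  show "hasse_taylor K $ n $ m = (fps_lift_const K + fps_const K) $ n $ m"
  proof (cases "n = 0 \<or> m = 0")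
    case True
    then show ?thesis
      using additive_fps_nth_0[OF assms]
      by (auto simp: hasse_taylor_def fps_lift_const_def hasse_deriv_nth)
  next
    case False
    have "of_nat ((m + n) choose n) * K $ (m + n) = 0"
    proof (cases "K $ (m + n) = 0")
      case nz: False
      then obtain a where "m + n = CHAR('a) ^ a"
        using K by (auto simp: additive_fps_def)
      then have "of_nat ((m + n) choose n) = (0::'a)"
        using of_nat_choose_CHAR_power[OF p, of n a] False by simp
      then show ?thesis by simp
    qed simp
    then show ?thesis
      using False by (simp add: hasse_taylor_def fps_lift_const_def hasse_deriv_nth)
  qed
qed

lemma hasse_deriv_power_additive:
  fixes K :: "'a::field fps"
  assumes "prime CHAR('a)" and "additive_fps K"
  shows "hasse_deriv n (K ^ k) $ m =
    (\<Sum>j\<le>k. of_nat (k choose j) * (K ^ j) $ n * (K ^ (k - j)) $ m)"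
proof -
  have "hasse_deriv n (K ^ k) = (fps_lift_const K + fps_const K) ^ k $ n"
    using hasse_taylor_power[of K k] hasse_taylor_additive[OF assms]
    by (metis fps_nth_Abs_fps hasse_taylor_def)
  also have "\<dots> = (\<Sum>j\<le>k. of_nat (k choose j) * (fps_const ((K ^ j) $ n) * K ^ (k - j)))"
    by (simp add: binomial_ring fps_lift_const_power fps_lift_const_nth fps_sum_nth
        fps_mult_of_nat_nth mult.assoc)
  finally show ?thesis
    by (simp add: fps_sum_nth fps_mult_of_nat_nth mult.assoc)
qed

text \<open>Take the coefficient of S^n in Q(K(T) + K(S)), expand each power binomially, and collect
  the powers of K(S) by their exponent \<open>j\<close>.\<close>

lemma hasse_deriv_compose_additive:
  fixes K :: "'a::field fps"
  assumes p: "prime CHAR('a)" and K: "additive_fps K"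
  shows "hasse_deriv n (Q oo K) $ m =
    (\<Sum>j\<le>n. (K ^ j) $ n * (hasse_deriv j Q oo K) $ m)"
proof -
  let ?g = "\<lambda>j i. Q $ (i + j) * (of_nat ((i + j) choose j) * (K ^ j) $ n * (K ^ i) $ m)"
  have vanish: "(K ^ j) $ l = 0" if "l < j" for j l
    using startsby_zero_power_prefix[OF additive_fps_nth_0[OF assms], of j] that by blast
  have "hasse_deriv n (Q oo K) $ m = (\<Sum>k\<le>n + m. Q $ k * hasse_deriv n (K ^ k) $ m)"
    by (simp add: hasse_deriv_nth fps_compose_nth sum_distrib_left atLeast0AtMost mult_ac add_ac)
  also have "\<dots> = (\<Sum>k\<le>n + m. \<Sum>j\<le>k. ?g j (k - j))"
    unfolding hasse_deriv_power_additive[OF assms] sum_distrib_left by simp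
  also have "\<dots> = (\<Sum>(j, i)\<in>{(j, i). j + i \<le> n + m}. ?g j i)"
    by (rule sum.triangle_reindex_eq[symmetric])
  \<comment> \<open>\<open>K ^ j\<close> has no terms of degree below \<open>j\<close>, so only
    \<open>j\<close> up to \<open>n\<close> and \<open>i\<close> up to \<open>m\<close>
    contribute.\<close>
  also have "\<dots> = (\<Sum>(j, i)\<in>{..n} \<times> {..m}. ?g j i)"
  proof (rule sum.mono_neutral_right)
    have "{(j, i). j + i \<le> n + m} \<subseteq> {..n + m} \<times> {..n + m}" by auto
    then show "finite {(j, i). j + i \<le> n + m}"
      using finite_subset by blast
  qed (auto simp: not_le, (metis vanish not_le)+)
  also have "\<dots> = (\<Sum>j\<le>n. \<Sum>i\<le>m. ?g j i)"
    by (simp add: sum.cartesian_product)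
  also have "\<dots> = (\<Sum>j\<le>n. (K ^ j) $ n * (hasse_deriv j Q oo K) $ m)"
    by (simp add: fps_compose_nth hasse_deriv_nth sum_distrib_left atLeast0AtMost mult_ac)
  finally show ?thesis .
qed

text \<open>Strong induction on the coefficients of K(H(T)) = T. For \<open>i\<close> a power of p,
  Frobenius confines \<open>H ^ i\<close> to degrees that are again powers of p. At any other degree
  \<open>n\<close> only the term with \<open>K $ n\<close> survives, with the nonzero factor
  \<open>(H $ 1) ^ n\<close>.\<close>

lemma additive_fps_inv:
  fixes H :: "'a::field fps"
  assumes p: "prime CHAR('a)" and H: "additive_fps H" and H1: "H $ 1 \<noteq> 0"
  shows "additive_fps (fps_inv H)"
proof -
  define K where "K = fps_inv H"
  have H0: "H $ 0 = 0" using additive_fps_nth_0[OF p H] .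
  have KH: "K oo H = fps_X" using fps_inv[OF H0 H1] by (simp add: K_def)
  have "K $ n = 0" if "\<nexists>m. n = CHAR('a) ^ m" for n
    using that
  proof (induction n rule: less_induct)
    case (less n)
    have n1: "n \<noteq> 1" using less.prems power_0[of "CHAR('a)"] by metis
    have "K $ i * (H ^ i) $ n = 0" if "i < n" for i
    proof (cases "\<exists>a. i = CHAR('a) ^ a")
      case True
      then obtain a where a: "i = CHAR('a) ^ a" by blast
      have "i > 0" using p by (simp add: a prime_gt_0_nat)
      have "H $ (n div i) = 0" if "i dvd n"
      proof (rule ccontr)
        assume "H $ (n div i) \<noteq> 0"
        then obtain b where "n div i = CHAR('a) ^ b"
          using H by (auto simp: additive_fps_def)
        then have "n = CHAR('a) ^ (a + b)"
          using dvd_mult_div_cancel[OF that] by (simp add: a power_add)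
        then show False using less.prems by blast
      qed
      then have "(H ^ i) $ n = 0"
        using fps_frobenius_nth[OF p a, of H n] \<open>i > 0\<close> by (simp split: if_splits)
      then show ?thesis by simp
    next
      case False
      then show ?thesis using less.IH that by simp
    qed
    then have "(\<Sum>i<n. K $ i * (H ^ i) $ n) = 0"
      by (intro sum.neutral) blast
    moreover have "{0..n} = insert n {..<n}" by auto
    ultimately have "(K oo H) $ n = K $ n * (H $ 1) ^ n"
      by (simp add: fps_compose_nth startsby_zero_power_nth_same[OF H0])
    then show ?case
      using n1 H1 unfolding KH by simp
  qed
  then show ?thesis unfolding additive_fps_def K_def by blast
qed


section \<open>Additive isomorphisms preserve integrality\<close>

lemma bounded_fpsE:
  assumes "P \<in> bounded_fps"
  obtains c where "c \<ge> 1" "\<And>n. vnorm (P $ n) \<le> c"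
proof -
  obtain c where "\<And>n. vnorm (P $ n) < c"
    using assms by (auto simp: bounded_fps_def)
  then have "\<And>n. vnorm (P $ n) \<le> max c 1"
    by (meson less_imp_le max.coboundedI1)
  then show ?thesis using that[of "max c 1"] by simp
qed

lemma vnorm_fps_power_nth_le_1:
  fixes K :: "'a::nonarch_complete_field fps"
  assumes "\<And>n. vnorm (K $ n) \<le> 1"
  shows "vnorm ((K ^ j) $ n) \<le> 1"
proof (induction j arbitrary: n)
  case (Suc j)
  have "vnorm (K $ i * (K ^ j) $ (n - i)) \<le> 1" for i
    using assms[of i] Suc[of "n - i"] by (simp add: vnorm_mult mult_le_one)
  then show ?case
    by (auto simp: fps_mult_nth intro!: vnorm_sum_le)
qed simp

text \<open>
  If \<open>b = vnorm (K $ p ^ r) > 1\<close> with \<open>r\<close> minimal, then for large \<open>d\<close> the coefficient of \<open>Q oo K\<close> at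
  \<open>p ^ (r + d * l)\<close>, where \<open>Q\<close> is the sum of the monomials with exponents \<open>p ^ (d * i)\<close>, is
  dominated by the contribution of \<open>i = l\<close>, whose norm \<open>b ^ p ^ (d * l)\<close> is unbounded in \<open>l\<close>.
\<close>

lemma additive_fps_coeff_le_1:
  fixes K :: "'a::nonarch_complete_field fps"
  assumes prime: "prime CHAR('a)" and K: "additive_fps K"
    and comp: "\<And>Q. Q \<in> bounded_fps \<Longrightarrow> Q oo K \<in> bounded_fps"
    and Kb: "K \<in> bounded_fps"
  shows "vnorm (K $ n) \<le> 1"
proof (rule ccontr)
  define p where "p = CHAR('a)"
  have p1: "p > 1" unfolding p_def using prime by (rule prime_gt_1_nat)
  define k where "k s = K $ (p ^ s)" for s
  assume big: "\<not> vnorm (K $ n) \<le> 1"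
  then have "K $ n \<noteq> 0" by auto
  then obtain s where "n = p ^ s" using K by (auto simp: additive_fps_def p_def)
  then have ex: "vnorm (k s) > 1" using big by (simp add: k_def)
  define r where "r = (LEAST s. vnorm (k s) > 1)"
  define b where "b = vnorm (k r)"
  have b: "b > 1" unfolding b_def r_def using ex by (rule LeastI)
  have min: "vnorm (k s) \<le> 1" if "s < r" for s
    using not_less_Least[of s "\<lambda>s. vnorm (k s) > 1"] that by (simp add: r_def)
  obtain C where C: "C \<ge> 1" "\<And>n. vnorm (K $ n) \<le> C" using bounded_fpsE[OF Kb] by metis
  \<comment> \<open>The spacing \<open>d\<close> of the exponents of \<open>Q\<close> must make
    \<open>b ^ (p ^ d)\<close> exceed the bound \<open>C\<close> on all coefficients of
    \<open>K\<close>: then the term \<open>l' < l\<close> loses against \<open>l\<close> although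
    its coefficient may be larger than \<open>b\<close>.\<close>
  obtain D where D: "C < b ^ D" using real_arch_pow[OF b] by blast
  define d where "d = Suc D"
  have "d > 0" by (simp add: d_def)
  have "D \<le> p ^ d" using power_gt_expt[of p d] p1 by (simp add: d_def)
  then have Cd: "C < b ^ (p ^ d)" using D b by (meson less_le_trans less_imp_le power_increasing)
  define Q :: "'a fps" where "Q = Abs_fps (\<lambda>n. if \<exists>l. n = p ^ (d * l) then 1 else 0)"
  have "Q \<in> bounded_fps" unfolding bounded_fps_def Q_def by (auto intro!: exI[of _ 2])
  then obtain c where c: "\<And>m. vnorm ((Q oo K) $ m) \<le> c" using comp bounded_fpsE by metis
  obtain l where l: "c < b ^ l" using real_arch_pow[OF b] by blast
  define N where "N = r + d * l"
  define a where "a = p ^ (d * l)"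
  let ?t = "\<lambda>i. Q $ i * (K ^ i) $ (p ^ N)"
  have t: "?t (p ^ (d * l')) = k (N - d * l') ^ (p ^ (d * l'))" if "d * l' \<le> N" for l'
  proof -
    have "p ^ (d * l') dvd p ^ N" "p ^ N div p ^ (d * l') = p ^ (N - d * l')"
      using that p1 by (auto simp: le_imp_power_dvd power_diff)
    then show ?thesis
      using fps_frobenius_nth[OF prime, of "p ^ (d * l')" "d * l'" K "p ^ N"]
      by (auto simp: Q_def k_def p_def)
  qed
  have ta: "vnorm (?t a) = b ^ a"
    using t[of l] by (simp add: a_def N_def b_def vnorm_power)
  have "vnorm (?t a) \<le> vnorm (\<Sum>i=0..p ^ N. ?t i)"
  proof (rule vnorm_dominant_le_sum)
    show "a \<in> {0..p ^ N}" using p1 by (simp add: a_def N_def power_increasing)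
    fix i assume i: "i \<in> {0..p ^ N}" "i \<noteq> a"
    have ba: "b ^ a > 1" using b p1 by (simp add: a_def one_less_power)
    show "vnorm (?t i) < vnorm (?t a)"
    proof (cases "\<exists>l'. i = p ^ (d * l')")
      case False
      then show ?thesis using ba ta by (simp add: Q_def)
    next
      case True
      then obtain l' where l': "i = p ^ (d * l')" by blast
      have le: "d * l' \<le> N" using i(1) p1 by (simp add: l')
      have ti: "vnorm (?t i) = vnorm (k (N - d * l')) ^ i"
        using t[OF le] by (simp add: l' vnorm_power)
      have "l' \<noteq> l" using i(2) by (auto simp: l' a_def)
      then consider "l < l'" | "l' < l" by linarith
      then show ?thesis
      proof cases
        \<comment> \<open>Here the coefficient of \<open>K\<close> involved has index below
          \<open>r\<close>, and minimality of \<open>r\<close> bounds it by 1.\<close>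
        case 1
        then have "d * l < d * l'" using \<open>d > 0\<close> by simp
        then have "N - d * l' < r" using le unfolding N_def by linarith
        then have "vnorm (?t i) \<le> 1"
          unfolding ti using min by (simp add: power_le_one)
        then show ?thesis using ba ta by linarith
      next
        case 2
        have "vnorm (?t i) \<le> C ^ i"
          unfolding ti k_def using C by (intro power_mono) auto
        also have "\<dots> < (b ^ (p ^ d)) ^ i"
          using Cd C p1 by (intro power_strict_mono) (auto simp: l')
        also have "\<dots> = b ^ (p ^ (d * Suc l'))"
          by (simp add: l' power_add flip: power_mult)
        also have "\<dots> \<le> b ^ a"
          unfolding a_def using b p1 2
          by (intro power_increasing mult_le_mono2) auto
        finally show ?thesis using ta by simp
      qed
    qed
  qed simp
  then have "b ^ a \<le> c"
    using c[of "p ^ N"] ta by (simp add: fps_compose_nth)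
  moreover have "l \<le> a"
  proof -
    have "l \<le> d * l" by (simp add: d_def)
    also have "\<dots> < p ^ (d * l)" using p1 by (intro power_gt_expt) simp
    finally show ?thesis by (simp add: a_def)
  qed
  then have "b ^ l \<le> b ^ a" using b by (intro power_increasing) auto
  ultimately show False using l by simp
qed

text \<open>Composition with \<open>K\<close> inverts \<open>\<phi>\<close>. As
  \<open>\<phi>\<close> maps the bounded series onto themselves, so does its inverse, and this lets
  \<open>additive_fps_coeff_le_1\<close> be applied to \<open>K\<close> itself.\<close>

lemma additive_iso_inverse:
  fixes \<phi> :: "'a::nonarch_complete_field fps \<Rightarrow> 'a fps"
  assumes p: "prime CHAR('a)" and \<phi>: "additive_iso \<phi>"
  defines "K \<equiv> fps_inv (\<phi> fps_X)"
  shows "additive_fps K"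
    and "\<phi> (P oo K) = P"
    and "\<phi> P oo K = P"
    and "Q \<in> bounded_fps \<Longrightarrow> Q oo K \<in> bounded_fps"
    and "vnorm (K $ n) \<le> 1"
    and "K ^ k \<in> bounded_fps"
    and "\<phi> (K ^ k) = fps_X ^ k"
proof -
  define H where "H = \<phi> fps_X"
  have H: "additive_fps H" and nH1: "vnorm (H $ 1) = 1" and \<phi>_eq: "\<And>P. \<phi> P = P oo H"
    and onto: "\<phi> ` bounded_fps = bounded_fps"
    using \<phi> unfolding additive_iso_def additive_fps_def H_def by blast+
  have H1: "H $ 1 \<noteq> 0" using nH1 by auto
  have K_eq: "K = fps_inv H" by (simp add: K_def H_def)
  show K: "additive_fps K"
    unfolding K_eq using additive_fps_inv[OF p H H1] .
  have H0: "H $ 0 = 0" and K0: "K $ 0 = 0"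
    using additive_fps_nth_0[OF p] H K by auto
  have KH: "K oo H = fps_X" and HK: "H oo K = fps_X"
    unfolding K_eq using fps_inv[OF H0 H1] fps_inv_right[OF H0 H1] .
  have inv1: "\<phi> (R oo K) = R" for R
    using fps_compose_assoc[OF H0 K0, of R] \<phi>_eq[of "R oo K"] KH fps_compose_fps_X[of R] by metis
  show "\<phi> (P oo K) = P" by (rule inv1)
  have inv2: "\<phi> R oo K = R" for R
    using fps_compose_assoc[OF K0 H0, of R] \<phi>_eq[of R] HK fps_compose_fps_X[of R] by metis
  show "\<phi> P oo K = P" by (rule inv2)
  have bd: "R oo K \<in> bounded_fps" if "R \<in> bounded_fps" for R
  proof -
    have "R \<in> \<phi> ` bounded_fps" using that by (simp only: onto)
    then obtain B where "R = \<phi> B" "B \<in> bounded_fps" by (rule imageE)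
    then show ?thesis using inv2[of B] by metis
  qed
  show "Q oo K \<in> bounded_fps" if "Q \<in> bounded_fps" using bd[OF that] .
  have X: "fps_X ^ j \<in> (bounded_fps :: 'a fps set)" for j
    unfolding bounded_fps_def by (auto intro!: exI[of _ 2])
  have XK: "fps_X ^ j oo K = K ^ j" for j
    using fps_compose_power[OF K0, of fps_X j] fps_X_fps_compose_startby0[OF K0] by metis
  have Kj: "K ^ j \<in> bounded_fps" for j
    using bd[OF X[of j]] XK[of j] by metis
  show "K ^ k \<in> bounded_fps" by (rule Kj)
  show "vnorm (K $ n) \<le> 1"
    using additive_fps_coeff_le_1[OF p K bd] Kj[of 1] by simp
  show "\<phi> (K ^ k) = fps_X ^ k"
    using inv1[of "fps_X ^ k"] XK[of k] by metis
qed

section \<open>Flow maps\<close>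

lemma umbra_power: "umbra \<alpha> ^ n = Poly_Mapping.single (Poly_Mapping.single \<alpha> n) 1"
  by (induction n) (simp_all add: umbra_def Poly_Mapping.mult_single flip: Poly_Mapping.single_add)

text \<open>The monomials that contribute are exactly the powers of one umbra, so the unordered sum
  over monomials becomes one over exponents. These powers evaluate to constants, which leaves only
  degree 0 in T.\<close>

lemma umbral_subst_eval:
  fixes ev :: "('u, 'a::nonarch_complete_field) umbral_poly \<Rightarrow> 'a fps"
  assumes ev: "umbral_calculus ev" and x: "x \<in> flow_domain ev \<F>" and G: "G \<in> bounded_fps"
  shows "umbral_admissible ev (umbra_subst G (\<F> x))"
    and "umbral_eval_series ev (umbra_subst G (\<F> x)) =
      fps_const (suminf (\<lambda>n. umbral_coeff ev \<F> n x * G $ n))"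
proof -
  define f where "f n = umbral_coeff ev \<F> n x" for n
  define s where "s = suminf (\<lambda>n. f n * G $ n)"
  define S where "S = umbra_subst G (\<F> x)"
  let ?t = "\<lambda>j m. (S m * ev (Poly_Mapping.single m 1)) $ j"
  have f0: "f \<longlonglongrightarrow> 0" using x by (simp add: flow_domain_def f_def[abs_def])
  have ev_const: "ev (Poly_Mapping.single (Poly_Mapping.single (\<F> x) n) 1) = fps_const (f n)" for n
  proof -
    have "ev (umbra (\<F> x) ^ n) \<in> range fps_const" using ev by (simp add: umbral_calculus_def)
    then show ?thesis by (auto simp: f_def umbral_coeff_def umbra_power)
  qed
  obtain c where "\<And>n. vnorm (G $ n) \<le> c" using bounded_fpsE[OF G] by metis
  then have "((\<lambda>n. f n * G $ n) has_sum s) UNIV"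
    unfolding s_def by (intro has_sum_null_seq tendsto_null_mult_bounded[OF f0])
  then have "((\<lambda>n. if j = 0 then f n * G $ n else 0) has_sum (if j = 0 then s else 0)) UNIV" for j :: nat
    by simp
  moreover have "?t j \<circ> Poly_Mapping.single (\<F> x) = (\<lambda>n. if j = 0 then f n * G $ n else 0)" for j
    by (auto simp: fun_eq_iff ev_const S_def umbra_subst_def mult.commute split: if_splits)
  ultimately have "(?t j has_sum (if j = 0 then s else 0)) (range (Poly_Mapping.single (\<F> x)))" for j
    by (subst has_sum_reindex) (auto intro: injI)
  moreover have "S m = 0" if "m \<notin> range (Poly_Mapping.single (\<F> x))" for m
  proof -
    have "m = Poly_Mapping.single (\<F> x) (Poly_Mapping.lookup m (\<F> x))"
      if "Poly_Mapping.keys m \<subseteq> {\<F> x}"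
      using that
      by (intro poly_mapping_eqI) (auto simp: Poly_Mapping.lookup_single when_def in_keys_iff)
    then show ?thesis using that by (auto simp: S_def umbra_subst_def)
  qed
  ultimately have sum: "(?t j has_sum (if j = 0 then s else 0)) UNIV" for j
    by (subst has_sum_cong_neutral[where T = "range (Poly_Mapping.single (\<F> x))" and g = "?t j"]) auto
  have "\<forall>m. S m \<noteq> 0 \<longrightarrow> Poly_Mapping.keys m \<subseteq> {\<F> x}"
    by (simp add: S_def umbra_subst_def)
  then show "umbral_admissible ev (umbra_subst G (\<F> x))"
    unfolding umbral_admissible_def S_def[symmetric]
    using has_sum_imp_summable[OF sum] by (intro conjI allI exI[of _ "{\<F> x}"]) auto
  show "umbral_eval_series ev (umbra_subst G (\<F> x)) =
      fps_const (suminf (\<lambda>n. umbral_coeff ev \<F> n x * G $ n))"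
    unfolding umbral_eval_series_def S_def[symmetric] f_def[symmetric] s_def[symmetric]
    by (rule fps_ext) (simp add: infsumI[OF sum])
qed

lemma vnorm_hasse_deriv_nth_le:
  assumes "\<And>n. vnorm (P $ n) \<le> c"
  shows "vnorm (hasse_deriv k P $ n) \<le> (c :: real)"
proof -
  have "vnorm (hasse_deriv k P $ n) \<le> 1 * c"
    unfolding hasse_deriv_nth vnorm_mult
    using assms by (intro mult_mono vnorm_of_nat_le_1) auto
  then show ?thesis by simp
qed

text \<open>Both coefficients equal the sum over \<open>j\<close> of \<open>g j * e j\<close>: on
  the left by \<open>hasse_deriv_compose_additive\<close> and an exchange of summations, on the
  right directly.\<close>

lemma flow_compose_additive:
  fixes K :: "'a::nonarch_complete_field fps" and f g :: "nat \<Rightarrow> 'a"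
  assumes p: "prime CHAR('a)" and K: "additive_fps K" and K1: "\<And>n. vnorm (K $ n) \<le> 1"
    and f: "f \<longlonglongrightarrow> 0" and g: "g \<longlonglongrightarrow> 0"
    and fg: "\<And>k. g k = suminf (\<lambda>n. f n * (K ^ k) $ n)"
    and Q: "Q \<in> bounded_fps"
  shows "Abs_fps (\<lambda>m. suminf (\<lambda>n. f n * hasse_deriv n (Q oo K) $ m)) =
    Abs_fps (\<lambda>i. suminf (\<lambda>j. g j * hasse_deriv j Q $ i)) oo K"
proof (rule fps_ext)
  fix m
  define e where "e j = (hasse_deriv j Q oo K) $ m" for j
  obtain c where c: "c \<ge> 1" "\<And>n. vnorm (Q $ n) \<le> c" using bounded_fpsE[OF Q] by metis
  note Kj = vnorm_fps_power_nth_le_1[OF K1]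
  have "vnorm (e j) \<le> c" for j
    unfolding e_def fps_compose_nth
  proof (rule vnorm_sum_le)
    fix i
    have "vnorm (hasse_deriv j Q $ i * (K ^ i) $ m) \<le> c * 1"
      unfolding vnorm_mult
      using vnorm_hasse_deriv_nth_le[OF c(2)] Kj c(1) by (intro mult_mono) auto
    then show "vnorm (hasse_deriv j Q $ i * (K ^ i) $ m) \<le> c" by simp
  qed (use c(1) in simp)
  then have bd: "vnorm ((K ^ j) $ n * e j) \<le> c" for n j
    using mult_mono[OF Kj[of j n], of "vnorm (e j)" c] by (simp add: vnorm_mult)
  have zero: "(K ^ j) $ n * e j = 0" if "n < j" for n j
    using startsby_zero_power_prefix[OF additive_fps_nth_0[OF p K], of j] that by simp
  have "(\<lambda>n. f n * (K ^ j) $ n) sums g j" for j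
    unfolding fg by (intro summable_sums summable_null_seq tendsto_null_mult_bounded[OF f Kj])
  from sums_mult_left_vnorm[OF this] have "(\<lambda>n. f n * ((K ^ j) $ n * e j)) sums (g j * e j)" for j
    by (simp add: mult_ac)
  from sums_triangle_swap[OF f bd zero this]
  have lhs: "(\<lambda>j. g j * e j) sums suminf (\<lambda>n. f n * hasse_deriv n (Q oo K) $ m)"
    by (simp add: hasse_deriv_compose_additive[OF p K] e_def)
  have "(\<lambda>j. g j * hasse_deriv j Q $ i) sums suminf (\<lambda>j. g j * hasse_deriv j Q $ i)" for i
    using vnorm_hasse_deriv_nth_le[OF c(2)]
    by (intro summable_sums summable_null_seq tendsto_null_mult_bounded[OF g])
  \<comment> \<open>The coefficient of T^m in a composition with \<open>K\<close> uses only degrees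
    \<open>i\<close> up to \<open>m\<close>, so this exchange involves a finite sum.\<close>
  then have "(\<lambda>j. \<Sum>i=0..m. (K ^ i) $ m * (g j * hasse_deriv j Q $ i)) sums
      (\<Sum>i=0..m. (K ^ i) $ m * suminf (\<lambda>j. g j * hasse_deriv j Q $ i))"
    by (intro sums_sum sums_mult_left_vnorm)
  then   have "(\<lambda>j. g j * e j) sums
      ((Abs_fps (\<lambda>i. suminf (\<lambda>j. g j * hasse_deriv j Q $ i)) oo K) $ m)"
    by (simp add: fps_compose_nth e_def sum_distrib_left mult_ac)
  with lhs show "Abs_fps (\<lambda>m. suminf (\<lambda>n. f n * hasse_deriv n (Q oo K) $ m)) $ m =
      (Abs_fps (\<lambda>i. suminf (\<lambda>j. g j * hasse_deriv j Q $ i)) oo K) $ m"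
    using sums_unique2 by simp
qed

lemma flow_map_nth_0: "flow_map ev \<F> x P $ 0 = suminf (\<lambda>k. umbral_coeff ev \<F> k x * P $ k)"
  by (simp add: flow_map_def hasse_deriv_nth)

lemma flow_map_X_power_nth_0: "flow_map ev \<F> x (fps_X ^ k) $ 0 = umbral_coeff ev \<F> k x"
proof -
  have "(\<lambda>j. umbral_coeff ev \<F> j x * fps_X ^ k $ j) =
      (\<lambda>j. if j = k then umbral_coeff ev \<F> j x else 0)"
    by auto
  then show ?thesis
    using sums_unique[OF sums_single[of k "\<lambda>j. umbral_coeff ev \<F> j x"]]
    by (simp add: flow_map_nth_0)
qed

lemma intertwines_iff:
  fixes ev :: "('u, 'a::nonarch_complete_field) umbral_poly \<Rightarrow> 'a fps"
  assumes p: "prime CHAR('a)" and \<phi>: "additive_iso \<phi>"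
    and x: "x \<in> flow_domain ev \<F> \<inter> flow_domain ev \<G>"
  shows "(\<forall>P \<in> bounded_fps. \<phi> (flow_map ev \<F> x P) = flow_map ev \<G> x (\<phi> P)) \<longleftrightarrow>
    (\<forall>k. umbral_coeff ev \<G> k x =
      suminf (\<lambda>n. umbral_coeff ev \<F> n x * (fps_inv (\<phi> fps_X) ^ k) $ n))"
    (is "?L \<longleftrightarrow> ?R")
proof
  note inv = additive_iso_inverse[OF p \<phi>]
  have \<phi>_eq: "\<phi> P = P oo \<phi> fps_X" for P
    using \<phi> unfolding additive_iso_def by blast
  show ?R if ?L
  proof
    fix k
    \<comment> \<open>Since \<open>\<phi>\<close> sends the k-th power of the inverse generator to
      T^k, the constant term on the other side is a single coefficient. Composition with the
      generator leaves constant terms unchanged.\<close>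
    have "umbral_coeff ev \<G> k x = \<phi> (flow_map ev \<F> x (fps_inv (\<phi> fps_X) ^ k)) $ 0"
      using that inv(6,7) by (simp add: flow_map_X_power_nth_0)
    then show "umbral_coeff ev \<G> k x =
        suminf (\<lambda>n. umbral_coeff ev \<F> n x * (fps_inv (\<phi> fps_X) ^ k) $ n)"
      by (simp only: \<phi>_eq[of "flow_map _ _ _ _"] fps_compose_nth_0 flow_map_nth_0)
  qed
  show ?L if ?R
  proof
    fix P :: "'a fps" assume "P \<in> bounded_fps"
    then have "\<phi> P \<in> \<phi> ` bounded_fps" by (rule imageI)
    moreover have "\<phi> ` bounded_fps = bounded_fps"
      using \<phi> unfolding additive_iso_def by (elim conjE)
    ultimately have "\<phi> P \<in> bounded_fps" by simp
    with flow_compose_additive[OF p inv(1,5), where f = "\<lambda>k. umbral_coeff ev \<F> k x"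
        and g = "\<lambda>k. umbral_coeff ev \<G> k x"] that x
    \<comment> \<open>The previous lemma is used with Q = \<open>\<phi> P\<close>, whose composition
      with the inverse generator is \<open>P\<close>. Applying \<open>\<phi>\<close> to both sides
      then gives the intertwining relation.\<close>
    have "flow_map ev \<F> x (\<phi> P oo fps_inv (\<phi> fps_X)) =
        flow_map ev \<G> x (\<phi> P) oo fps_inv (\<phi> fps_X)"
      unfolding flow_map_def by (simp add: flow_domain_def)
    then show "\<phi> (flow_map ev \<F> x P) = flow_map ev \<G> x (\<phi> P)"
      by (simp add: inv(2,3))
  qed
qed

theorem theorem4p10:
  fixes ev :: "('u, 'a::nonarch_complete_field) umbral_poly \<Rightarrow> 'a fps"
    and \<F> \<G> :: "'a \<Rightarrow> 'u"
  assumes "CHAR('a) > 0"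
    and "umbral_calculus ev"
  shows "dual_flow ev \<F> \<G> \<longleftrightarrow>
    (\<exists>\<phi>. additive_iso \<phi> \<and>
      (\<forall>k. \<forall>x \<in> flow_domain ev \<F> \<inter> flow_domain ev \<G>.
         umbral_admissible ev (umbra_subst (fps_inv (\<phi> fps_X) ^ k) (\<F> x)) \<and>
         fps_const (umbral_coeff ev \<G> k x) =
           umbral_eval_series ev (umbra_subst (fps_inv (\<phi> fps_X) ^ k) (\<F> x))))"
proof -
  have p: "prime CHAR('a)" using assms(1) by (rule prime_CHAR_semidom)
  \<comment> \<open>The two conditions are equivalent for each \<open>\<phi>\<close> and each
    \<open>x\<close> separately, so the same isomorphism serves in both directions.\<close>
  have "(\<forall>P \<in> bounded_fps. \<phi> (flow_map ev \<F> x P) = flow_map ev \<G> x (\<phi> P)) \<longleftrightarrow>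
      (\<forall>k. umbral_admissible ev (umbra_subst (fps_inv (\<phi> fps_X) ^ k) (\<F> x)) \<and>
         fps_const (umbral_coeff ev \<G> k x) =
           umbral_eval_series ev (umbra_subst (fps_inv (\<phi> fps_X) ^ k) (\<F> x)))"
    if \<phi>: "additive_iso \<phi>" and x: "x \<in> flow_domain ev \<F> \<inter> flow_domain ev \<G>" for \<phi> x
    using umbral_subst_eval[OF assms(2) _ additive_iso_inverse(6)[OF p \<phi>], of x \<F>] x
    by (simp add: intertwines_iff[OF p \<phi> x])
  then show ?thesis
    unfolding dual_flow_def by blast
qed

end
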